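(* Let $(X,T)$ be a topologically transitive dynamical system without isolated points. If there is a subsystem $(Y,T)$ of $(X,T)$ such that $(X\times Y,T\times T)$ is transitive, then $(X,T)$ is densely uniformly chaotic.
   Context: A dynamical system (TDS) $(X,T)$ is a nonempty compact metric space $(X,d)$ with a continuous surjective map $T:X\to X$. It is (topologically) transitive if for all nonempty open $U,V\subseteq X$ there is $n\in\mathbb Z_+$ with $U\cap T^{-n}V\neq\emptyset$. A subsystem is given by a nonempty closed $T$-invariant subset $Y\subseteq X$ with the restriction of $T$. A subset $K\subseteq X$ is rigid if there is a sequence $n_k\nearrow+\infty$ with $\lim_k T^{n_k}x=x$ for every $x\in K$. It is uniformly rigid if for every $\epsilon>0$ there is an integer $n\ge 1$ with $d(T^nx,x)<\epsilon$ for all $x\in K$. It is uniformly proximal if for every $\epsilon>0$ there is $n\in\mathbb Z_+$ with $\mathrm{diam}\,T^nK<\epsilon$. It is proximal if every finite subset of $K$ is uniformly proximal. A subset $K\subseteq X$ is a uniformly chaotic set if there are Cantor sets $C_1\subseteq C_2\subseteq\cdots$ such that $K=\bigcup_{n}C_n$ is a rigid and a proximal subset of $X$, and each $C_N$ is uniformly rigid and uniformly proximal. $(X,T)$ is densely uniformly chaotic if it has a uniformly chaotic subset that is dense in $X$. *)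

theory Defs
  imports "HOL-Analysis.Analysis"
begin

(* A system is carried by a subset X of a metric space; T matters only on X, and open
   sets of the system are the relatively open subsets of X. *)
definition dynamical_system :: "'a::metric_space set \<Rightarrow> ('a \<Rightarrow> 'a) \<Rightarrow> bool" where
  "dynamical_system X T \<longleftrightarrow> X \<noteq> {} \<and> compact X \<and> continuous_on X T \<and> T ` X = X"

definition topologically_transitive ::
  "'a::topological_space set \<Rightarrow> ('a \<Rightarrow> 'a) \<Rightarrow> bool" where
  "topologically_transitive X T \<longleftrightarrow>
     (\<forall>U V. openin (top_of_set X) U \<and> U \<noteq> {} \<and> openin (top_of_set X) V \<and> V \<noteq> {}
        \<longrightarrow> (\<exists>n. U \<inter> (T ^^ n) -` V \<noteq> {}))"

(* Invariance is T(Y) \<subseteq> Y; surjectivity of T on Y is not demanded separately. *)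
definition subsystem :: "'a::metric_space set \<Rightarrow> ('a \<Rightarrow> 'a) \<Rightarrow> 'a set \<Rightarrow> bool" where
  "subsystem X T Y \<longleftrightarrow> Y \<noteq> {} \<and> closedin (top_of_set X) Y \<and> T ` Y \<subseteq> Y"

definition rigid :: "('a::metric_space \<Rightarrow> 'a) \<Rightarrow> 'a set \<Rightarrow> bool" where
  "rigid T K \<longleftrightarrow>
     (\<exists>n :: nat \<Rightarrow> nat. incseq n \<and> filterlim n at_top sequentially \<and>
        (\<forall>x\<in>K. (\<lambda>k. (T ^^ n k) x) \<longlonglongrightarrow> x))"

definition uniformly_rigid :: "('a::metric_space \<Rightarrow> 'a) \<Rightarrow> 'a set \<Rightarrow> bool" where
  "uniformly_rigid T K \<longleftrightarrow> (\<forall>\<epsilon>>0. \<exists>n\<ge>1. \<forall>x\<in>K. dist ((T ^^ n) x) x < \<epsilon>)"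

definition uniformly_proximal :: "('a::metric_space \<Rightarrow> 'a) \<Rightarrow> 'a set \<Rightarrow> bool" where
  "uniformly_proximal T K \<longleftrightarrow> (\<forall>\<epsilon>>0. \<exists>n. diameter ((T ^^ n) ` K) < \<epsilon>)"

definition proximal :: "('a::metric_space \<Rightarrow> 'a) \<Rightarrow> 'a set \<Rightarrow> bool" where
  "proximal T K \<longleftrightarrow> (\<forall>F. finite F \<and> F \<subseteq> K \<longrightarrow> uniformly_proximal T F)"

(* nat \<Rightarrow> bool carries the product topology of the discrete topology on bool. *)
definition cantor_set :: "'a::topological_space set \<Rightarrow> bool" where
  "cantor_set C \<longleftrightarrow> C homeomorphic (UNIV :: (nat \<Rightarrow> bool) set)"

definition uniformly_chaotic_set ::
  "'a::metric_space set \<Rightarrow> ('a \<Rightarrow> 'a) \<Rightarrow> 'a set \<Rightarrow> bool" where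
  "uniformly_chaotic_set X T K \<longleftrightarrow> K \<subseteq> X \<and>
     (\<exists>C :: nat \<Rightarrow> 'a set.
        (\<forall>n. cantor_set (C n)) \<and> (\<forall>n. C n \<subseteq> C (Suc n)) \<and> K = (\<Union>n. C n) \<and>
        rigid T K \<and> proximal T K \<and>
        (\<forall>n. uniformly_rigid T (C n) \<and> uniformly_proximal T (C n)))"

definition densely_uniformly_chaotic :: "'a::metric_space set \<Rightarrow> ('a \<Rightarrow> 'a) \<Rightarrow> bool" where
  "densely_uniformly_chaotic X T \<longleftrightarrow>
     (\<exists>K. uniformly_chaotic_set X T K \<and> X \<subseteq> closure K)"

end

theory Submission
  imports Defs
begin

text \<open>
  The chaotic set is grown as a union of countably many Cantor trees, the \<open>j\<close>-th one inside the
  \<open>j\<close>-th member of a countable family of open sets that has a member in every ball around a point of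
  \<open>X\<close>. At stage \<open>k\<close> finitely many pairwise disjoint small open sets are present, and they are shrunk
  so that all their points return \<open>1 / (k + 1)\<close>-close to themselves at one common time \<open>m \<ge> k\<close>, and
  all their points are \<open>1 / (k + 1)\<close>-close to each other at another common time. Then every set is
  split into two, a new set starts a new tree, and the procedure is repeated. If \<open>C N\<close> is the union of
  the first \<open>N + 1\<close> limit Cantor sets, it is covered by the open sets of every stage \<open>k \<ge> N\<close>. This
  gives uniform rigidity and uniform proximality of \<open>C N\<close>, with the arbitrarily late return times
  that are needed for a single rigidity sequence on the union.

  It remains to see why any finitely many nonempty open sets \<open>U\<^sub>1, \<dots>, U\<^sub>r\<close> contain points with
  these two properties.

  \<^item> Return (\<open>rigid_refinement\<close>): by transitivity one nonempty open set \<open>V\<close> is mapped into each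
  \<open>U\<^sub>i\<close> by some iterate \<open>T\<^sup>k\<close>, \<open>k = k\<^sub>i\<close>. A point of \<open>V\<close> that returns close to itself takes
  its images in all the \<open>U\<^sub>i\<close> along.

  \<^item> Contraction (\<open>proximal_refinement\<close>): let \<open>W\<close> be a small ball around a point of \<open>Y\<close>. Furstenberg's
  intersection argument, applied to the transitive product \<open>X \<times> Y\<close>, shows that the sets of times at
  which \<open>U\<^sub>1, \<dots>, U\<^sub>r\<close> hit \<open>W\<close> all contain the set of times at which some open \<open>A\<close> hits some
  open \<open>B\<close>. Hence there is a time at which all the \<open>U\<^sub>i\<close> have points in \<open>W\<close>.
\<close>

section \<open>Cantor sets from nested trees of sets\<close>

lemma compact_UNIV_bool_seq: "compact (UNIV :: (nat \<Rightarrow> bool) set)"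
proof -
  have "compactin (product_topology (\<lambda>i. euclidean) UNIV) (PiE (UNIV :: nat set) (\<lambda>i. UNIV :: bool set))"
    unfolding compactin_PiE by (simp add: finite_imp_compact)
  then show ?thesis
    by (simp add: euclidean_product_topology)
qed

lemma cantor_set_range:
  fixes f :: "(nat \<Rightarrow> bool) \<Rightarrow> 'a::metric_space"
  assumes "continuous_on UNIV f" "inj f"
  shows "cantor_set (range f)"
  unfolding cantor_set_def
  using homeomorphic_compact[OF compact_UNIV_bool_seq assms(1) refl assms(2)] homeomorphic_sym by blast

lemma cantor_set_obtain_parametrization:
  fixes C :: "'a::metric_space set"
  assumes "cantor_set C"
  obtains f :: "(nat \<Rightarrow> bool) \<Rightarrow> 'a" where "continuous_on UNIV f" "inj f" "range f = C"
proof -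
  obtain f :: "(nat \<Rightarrow> bool) \<Rightarrow> 'a" and g where "homeomorphism UNIV C f g"
    using assms homeomorphic_sym unfolding cantor_set_def homeomorphic_def by blast
  then have "continuous_on UNIV f" "range f = C" "\<And>\<sigma>. g (f \<sigma>) = \<sigma>"
    unfolding homeomorphism_def by auto
  then show ?thesis
    using that[of f] by (metis injI)
qed

text \<open>The first bit of a binary sequence decides which of the two sets the point belongs to.\<close>

lemma cantor_set_Un:
  fixes C D :: "'a::metric_space set"
  assumes "cantor_set C" "cantor_set D" "C \<inter> D = {}"
  shows "cantor_set (C \<union> D)"
proof -
  obtain f :: "(nat \<Rightarrow> bool) \<Rightarrow> 'a" where f: "continuous_on UNIV f" "inj f" "range f = C"
    using cantor_set_obtain_parametrization[OF assms(1)] .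
  obtain g :: "(nat \<Rightarrow> bool) \<Rightarrow> 'a" where g: "continuous_on UNIV g" "inj g" "range g = D"
    using cantor_set_obtain_parametrization[OF assms(2)] .
  define tail :: "(nat \<Rightarrow> bool) \<Rightarrow> nat \<Rightarrow> bool" where "tail \<sigma> = (\<lambda>n. \<sigma> (Suc n))" for \<sigma>
  define h where "h \<sigma> = (if \<sigma> 0 then f (tail \<sigma>) else g (tail \<sigma>))" for \<sigma>
  have tail: "continuous_on S tail" for S
    unfolding tail_def
    by (intro continuous_on_coordinatewise_then_product
        continuous_on_subset[OF continuous_on_product_coordinates subset_UNIV])
  have closed_head: "closed {\<sigma> :: nat \<Rightarrow> bool. \<sigma> 0 = b}" for b
    using closed_vimage[of "{b}" "\<lambda>\<sigma> :: nat \<Rightarrow> bool. \<sigma> 0"]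
    by (simp add: vimage_def closed_def open_discrete)
  have "continuous_on ({\<sigma>. \<sigma> 0 = True} \<union> {\<sigma>. \<sigma> 0 = False}) h"
    unfolding h_def
    by (intro continuous_on_If closed_head
        continuous_on_compose2[OF f(1) tail] continuous_on_compose2[OF g(1) tail]) auto
  moreover have "{\<sigma> :: nat \<Rightarrow> bool. \<sigma> 0 = True} \<union> {\<sigma>. \<sigma> 0 = False} = UNIV"
    by auto
  ultimately have "continuous_on UNIV h"
    by simp
  moreover have "inj h"
  proof (rule injI)
    fix \<sigma> \<tau> assume eq: "h \<sigma> = h \<tau>"
    have "f \<rho> \<noteq> g \<rho>'" for \<rho> \<rho>'
      using f(3) g(3) assms(3) by auto
    with eq have "\<sigma> 0 = \<tau> 0" "tail \<sigma> = tail \<tau>"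
      using f(2) g(2) by (auto simp: h_def inj_eq split: if_splits dest: sym)
    then have "\<sigma> n = \<tau> n" for n
      unfolding tail_def by (cases n) (auto dest: fun_cong)
    then show "\<sigma> = \<tau>" ..
  qed
  moreover have "range h = C \<union> D"
  proof -
    have "f \<sigma> \<in> range h" "g \<sigma> \<in> range h" for \<sigma>
      using rangeI[of h "case_nat True \<sigma>"] rangeI[of h "case_nat False \<sigma>"]
      by (simp_all add: h_def tail_def)
    moreover have "h \<sigma> \<in> C \<union> D" for \<sigma>
      using f(3) g(3) by (auto simp: h_def)
    ultimately show ?thesis
      using f(3) g(3) by blast
  qed
  ultimately show ?thesis
    using cantor_set_range by metis
qed

text \<open>The path \<open>branch \<sigma>\<close> from the root lists the bits of \<open>\<sigma>\<close> with the latest bit first, so that a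
  child of the node \<open>s\<close> has the form \<open>b # s\<close>.\<close>

primrec branch :: "(nat \<Rightarrow> bool) \<Rightarrow> nat \<Rightarrow> bool list" where
  "branch \<sigma> 0 = []"
| "branch \<sigma> (Suc n) = \<sigma> n # branch \<sigma> n"

lemma length_branch [simp]: "length (branch \<sigma> n) = n"
  by (induction n) auto

lemma branch_cong: "(\<And>i. i < n \<Longrightarrow> \<sigma> i = \<tau> i) \<Longrightarrow> branch \<sigma> n = branch \<tau> n"
  by (induction n) auto

text \<open>Along every branch the closures are nested and compact, so they have a common point; small
  diameters make it depend continuously on the branch, and disjointness makes it determine the
  branch.\<close>

lemma tree_parametrization:
  fixes A :: "bool list \<Rightarrow> 'a::metric_space set"
  assumes "compact X" and "A [] \<subseteq> X"
    and nonempty: "\<And>s. A s \<noteq> {}"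
    and nested: "\<And>b s. closure (A (b # s)) \<subseteq> A s"
    and small: "\<And>s x y. x \<in> A s \<Longrightarrow> y \<in> A s \<Longrightarrow> dist x y \<le> e (length s)"
    and "e \<longlonglongrightarrow> 0"
    and disjoint: "\<And>s t. length s = length t \<Longrightarrow> s \<noteq> t \<Longrightarrow> A s \<inter> A t = {}"
  shows "\<exists>f. continuous_on UNIV f \<and> inj f \<and> (\<forall>\<sigma> n. f \<sigma> \<in> A (branch \<sigma> n))"
proof -
  have "\<exists>x. \<forall>n. x \<in> A (branch \<sigma> n)" for \<sigma>
  proof -
    let ?F = "\<lambda>n. closure (A (branch \<sigma> n))"
    have step: "A (branch \<sigma> (Suc n)) \<subseteq> A (branch \<sigma> n)" for n
      using nested closure_subset by fastforce
    have mono: "A (branch \<sigma> n) \<subseteq> A (branch \<sigma> m)" if "m \<le> n" for m n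
      using lift_Suc_antimono_le[of "\<lambda>n. A (branch \<sigma> n)"] step that by blast
    have "X \<inter> (\<Inter>n\<in>UNIV. ?F n) \<noteq> {}"
    proof (rule compact_imp_fip_image[OF \<open>compact X\<close>])
      fix I :: "nat set" assume "finite I"
      then have "A (branch \<sigma> (Max (insert 0 I))) \<subseteq> ?F i" if "i \<in> I" for i
        using mono[of i "Max (insert 0 I)"] that closure_subset by fastforce
      moreover have "A (branch \<sigma> (Max (insert 0 I))) \<subseteq> X"
        using mono[of 0] \<open>A [] \<subseteq> X\<close> by fastforce
      ultimately show "X \<inter> (\<Inter>n\<in>I. ?F n) \<noteq> {}"
        using nonempty[of "branch \<sigma> (Max (insert 0 I))"] by blast
    qed auto
    then obtain x where "x \<in> ?F (Suc n)" for n
      by blast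
    then show ?thesis
      using nested by (metis branch.simps(2) subsetD)
  qed
  then obtain f where f: "\<And>\<sigma> n. f \<sigma> \<in> A (branch \<sigma> n)"
    by metis
  have "(f \<longlongrightarrow> f \<sigma>) (at \<sigma>)" for \<sigma>
    unfolding tendsto_iff
  proof (intro allI impI)
    fix r :: real assume "r > 0"
    then obtain n where n: "e n < r"
      using \<open>e \<longlonglongrightarrow> 0\<close> by (metis order_tendstoD(2) eventually_happens sequentially_bot)
    let ?O = "\<Inter>i\<in>{..<n}. (\<lambda>\<tau>. \<tau> i) -` {\<sigma> i}"
    have "open ?O"
      by (intro open_INT finite_lessThan ballI open_vimage open_discrete
          continuous_on_product_coordinates)
    moreover have "dist (f \<tau>) (f \<sigma>) < r" if "\<tau> \<in> ?O" for \<tau>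
    proof -
      have "branch \<tau> n = branch \<sigma> n"
        using that by (intro branch_cong) auto
      then show ?thesis
        using small[of "f \<tau>" "branch \<sigma> n" "f \<sigma>"] f[of \<tau> n] f[of \<sigma> n] n by simp
    qed
    moreover have "\<sigma> \<in> ?O"
      by simp
    ultimately show "\<forall>\<^sub>F \<tau> in at \<sigma>. dist (f \<tau>) (f \<sigma>) < r"
      unfolding eventually_at_topological by blast
  qed
  then have "continuous_on UNIV f"
    by (simp add: continuous_on_def)
  moreover have "inj f"
  proof (rule injI, rule ccontr)
    fix \<sigma> \<tau> assume "f \<sigma> = f \<tau>" and "\<sigma> \<noteq> \<tau>"
    then obtain n where "\<sigma> n \<noteq> \<tau> n"
      by blast
    then have "A (branch \<sigma> (Suc n)) \<inter> A (branch \<tau> (Suc n)) = {}"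
      by (intro disjoint) auto
    then show False
      using f[of \<sigma> "Suc n"] f[of \<tau> "Suc n"] \<open>f \<sigma> = f \<tau>\<close> by auto
  qed
  ultimately show ?thesis
    using f by blast
qed

section \<open>Rigidity and proximality of increasing unions\<close>

text \<open>Large rigidity times allow an increasing sequence of times, the \<open>k\<close>-th of which moves the
  points of \<open>C k\<close> by less than \<open>1 / (k + 1)\<close>.\<close>

lemma rigid_increasing_Union:
  assumes "\<And>i. C i \<subseteq> C (Suc i)"
    and returns: "\<And>i M \<epsilon>. \<epsilon> > 0 \<Longrightarrow> \<exists>m\<ge>M. \<forall>x\<in>C i. dist ((T ^^ m) x) x < \<epsilon>"
  shows "rigid T (\<Union>i. C i)"
proof -
  have "\<exists>n. \<forall>k. (\<forall>x\<in>C k. dist ((T ^^ n k) x) x < 1 / Suc k) \<and> n k < n (Suc k)"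
  proof (rule dependent_nat_choice)
    show "\<exists>m. \<forall>x\<in>C 0. dist ((T ^^ m) x) x < 1 / Suc 0"
      using returns[of "1 / Suc 0" 0 0] by auto
    show "\<exists>m'. (\<forall>x\<in>C (Suc k). dist ((T ^^ m') x) x < 1 / Suc (Suc k)) \<and> m < m'" for m k
      using returns[of "1 / Suc (Suc k)" "Suc m" "Suc k"] by (auto simp: Suc_le_eq)
  qed
  then obtain n where n: "\<And>k x. x \<in> C k \<Longrightarrow> dist ((T ^^ n k) x) x < 1 / Suc k"
    and "\<And>k. n k < n (Suc k)"
    by blast
  then have "strict_mono n"
    by (simp add: strict_mono_Suc_iff)
  moreover have "(\<lambda>k. (T ^^ n k) x) \<longlonglongrightarrow> x" if "x \<in> C i" for x i
  proof -
    have "x \<in> C k" if "i \<le> k" for k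
      using lift_Suc_mono_le[of C i k] assms(1) that \<open>x \<in> C i\<close> by blast
    then have "\<forall>\<^sub>F k in sequentially. dist ((T ^^ n k) x) x \<le> 1 / Suc k"
      using n by (intro eventually_sequentiallyI[of i]) (simp add: less_imp_le)
    moreover have "(\<lambda>k. 1 / real (Suc k)) \<longlonglongrightarrow> 0"
      using LIMSEQ_inverse_real_of_nat by (simp add: inverse_eq_divide)
    ultimately have "(\<lambda>k. dist ((T ^^ n k) x) x) \<longlonglongrightarrow> 0"
      by (rule tendsto_sandwich[OF always_eventually _ tendsto_const, rotated]) simp
    then show ?thesis
      by (subst tendsto_dist_iff)
  qed
  ultimately show ?thesis
    unfolding rigid_def
    using strict_mono_mono[of n] filterlim_subseq[of n] by (intro exI[of _ n]) auto
qed

text \<open>A finite subset of the union already lies in one of the sets.\<close>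

lemma proximal_increasing_Union:
  assumes "\<And>i. C i \<subseteq> C (Suc i)"
    and "\<And>i. uniformly_proximal T (C i)"
    and "\<And>i n. bounded ((T ^^ n) ` C i)"
  shows "proximal T (\<Union>i. C i)"
  unfolding proximal_def uniformly_proximal_def
proof (intro allI impI)
  fix F and \<epsilon> :: real assume F: "finite F \<and> F \<subseteq> (\<Union>i. C i)" and "\<epsilon> > 0"
  have mono: "C i \<subseteq> C j" if "i \<le> j" for i j
    using lift_Suc_mono_le[of C i j] assms(1) that by blast
  obtain h where h: "\<And>x. x \<in> F \<Longrightarrow> x \<in> C (h x)"
    using F by (simp add: subset_iff) metis
  define i where "i = Max (h ` F)"
  have i: "F \<subseteq> C i"
  proof
    fix x assume "x \<in> F"
    then have "h x \<le> i"
      unfolding i_def using F by simp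
    then show "x \<in> C i"
      using mono h[OF \<open>x \<in> F\<close>] by blast
  qed
  obtain n where "diameter ((T ^^ n) ` C i) < \<epsilon>"
    using assms(2) \<open>\<epsilon> > 0\<close> unfolding uniformly_proximal_def by blast
  then have "diameter ((T ^^ n) ` F) < \<epsilon>"
    using diameter_subset[OF image_mono[OF i] assms(3)] by (meson le_less_trans)
  then show "\<exists>n. diameter ((T ^^ n) ` F) < \<epsilon>" ..
qed

lemma uniformly_proximal_of_dist_le:
  assumes "\<And>\<epsilon>. \<epsilon> > 0 \<Longrightarrow> \<exists>n. \<forall>x\<in>K. \<forall>y\<in>K. dist ((T ^^ n) x) ((T ^^ n) y) \<le> \<epsilon>"
  shows "uniformly_proximal T K"
  unfolding uniformly_proximal_def
proof (intro allI impI)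
  fix \<epsilon> :: real assume "\<epsilon> > 0"
  then obtain n where n: "\<And>x y. x \<in> K \<Longrightarrow> y \<in> K \<Longrightarrow> dist ((T ^^ n) x) ((T ^^ n) y) \<le> \<epsilon> / 2"
    using assms[of "\<epsilon> / 2"] by auto
  have "diameter ((T ^^ n) ` K) \<le> \<epsilon> / 2"
  proof (cases "K = {}")
    case False
    then show ?thesis
      unfolding diameter_def using n by (auto intro!: cSUP_least simp del: le_divide_eq_numeral1)
  qed (use \<open>\<epsilon> > 0\<close> in simp)
  then show "\<exists>n. diameter ((T ^^ n) ` K) < \<epsilon>"
    using \<open>\<epsilon> > 0\<close> by (intro exI[of _ n]) linarith
qed

section \<open>Moving finite families of open sets\<close>

locale transitive_system =
  fixes X :: "'a::metric_space set" and T :: "'a \<Rightarrow> 'a"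
  assumes system: "dynamical_system X T" and transitive: "topologically_transitive X T"
begin

abbreviation nonempty_open :: "'a set \<Rightarrow> bool" where
  "nonempty_open U \<equiv> openin (top_of_set X) U \<and> U \<noteq> {}"

lemma continuous_iterate: "continuous_on X (T ^^ n)"
  and image_iterate: "(T ^^ n) ` X = X"
proof (induction n)
  case (Suc n)
  have "continuous_on X T" "T ` X = X"
    using system by (auto simp: dynamical_system_def)
  {
    case 1
    then show ?case
      using Suc continuous_on_compose2[OF \<open>continuous_on X T\<close>, of X "T ^^ n"] by simp
  next
    case 2
    then show ?case
      using Suc \<open>T ` X = X\<close> by (metis funpow.simps(2) image_comp)
  }
qed auto

lemma iterate_in: "x \<in> X \<Longrightarrow> (T ^^ n) x \<in> X"
  using image_iterate by blast

lemma open_preimage_iterate: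
  "openin (top_of_set X) V \<Longrightarrow> openin (top_of_set X) (X \<inter> (T ^^ n) -` V)"
  using continuous_openin_preimage[OF continuous_iterate] iterate_in by blast

lemma open_visit:
  assumes "openin (top_of_set X) U" "openin (top_of_set X) V"
  shows "openin (top_of_set X) (U \<inter> (T ^^ n) -` V)"
proof -
  have "U \<inter> (T ^^ n) -` V = U \<inter> (X \<inter> (T ^^ n) -` V)"
    using openin_imp_subset[OF assms(1)] by blast
  then show ?thesis
    using openin_Int[OF assms(1) open_preimage_iterate[OF assms(2)]] by metis
qed

lemma visit_exists:
  assumes "nonempty_open U" "nonempty_open V"
  obtains n where "nonempty_open (U \<inter> (T ^^ n) -` V)"
proof -
  obtain n where "U \<inter> (T ^^ n) -` V \<noteq> {}"
    using assms transitive unfolding topologically_transitive_def by meson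
  then show ?thesis
    using that[of n] open_visit[of U V n] assms by simp
qed

lemma nonempty_open_preimage_iterate:
  assumes "nonempty_open V"
  shows "nonempty_open (X \<inter> (T ^^ n) -` V)"
proof -
  obtain y where y: "y \<in> V"
    using assms by blast
  then have "y \<in> (T ^^ n) ` X"
    using image_iterate openin_imp_subset[OF conjunct1[OF assms]] by blast
  then show ?thesis
    using y open_preimage_iterate assms by blast
qed

text \<open>Because \<open>T\<close> maps \<open>X\<close> onto \<open>X\<close>, the set of points that enter \<open>V\<close> after \<open>M\<close> steps is nonempty
  and open. An orbit from \<open>V\<close> into that set returns to \<open>V\<close> at a time that is at least \<open>M\<close>.\<close>

lemma return_time:
  assumes "nonempty_open V"
  obtains m x where "m \<ge> M" "x \<in> V" "(T ^^ m) x \<in> V"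
proof -
  obtain n where "nonempty_open (V \<inter> (T ^^ n) -` (X \<inter> (T ^^ M) -` V))"
    using visit_exists assms nonempty_open_preimage_iterate by metis
  then obtain x where "x \<in> V" "(T ^^ M) ((T ^^ n) x) \<in> V"
    by blast
  then show ?thesis
    using that[of "M + n" x] by (simp add: funpow_add)
qed

text \<open>Several open sets are reduced to one: shrinking \<open>V\<close> to the part that visits the next \<open>U i\<close>
  keeps the visits arranged before.\<close>

lemma common_source:
  assumes "finite I" "\<And>i. i \<in> I \<Longrightarrow> nonempty_open (U i)"
  shows "\<exists>V k. nonempty_open V \<and> (\<forall>i\<in>I. \<forall>x\<in>V. (T ^^ k i) x \<in> U i)"
  using assms
proof (induction I rule: finite_induct)
  case empty
  have "nonempty_open X"
    using system by (simp add: dynamical_system_def)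
  then show ?case
    by blast
next
  case (insert j I)
  have "\<exists>V k. nonempty_open V \<and> (\<forall>i\<in>I. \<forall>x\<in>V. (T ^^ k i) x \<in> U i)"
    using insert.prems by (intro insert.IH) blast
  then obtain V k where V: "nonempty_open V" "\<forall>i\<in>I. \<forall>x\<in>V. (T ^^ k i) x \<in> U i"
    by blast
  obtain n where n: "nonempty_open (V \<inter> (T ^^ n) -` U j)"
    using visit_exists[OF V(1) insert.prems[OF insertI1]] .
  have "\<forall>i\<in>insert j I. \<forall>x\<in>V \<inter> (T ^^ n) -` U j. (T ^^ (k(j := n)) i) x \<in> U i"
    using V(2) insert.hyps(2) by auto
  with n show ?case
    by blast
qed

lemma open_dist_less:
  assumes "continuous_on X f" "continuous_on X g"
  shows "openin (top_of_set X) {x \<in> X. dist (f x) (g x) < r}"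
proof -
  have "openin (top_of_set X) (X \<inter> (\<lambda>x. dist (f x) (g x)) -` {..<r})"
    by (intro continuous_openin_preimage_gen continuous_on_dist assms open_lessThan)
  then show ?thesis
    by (simp add: Int_def vimage_def)
qed

text \<open>A point \<open>x\<close> of a small common source that returns close to itself at time \<open>m\<close> makes all the
  points \<open>(T ^^ k i) x\<close> return at that same time, because \<open>T ^^ m\<close> commutes with \<open>T ^^ k i\<close>.\<close>

lemma rigid_refinement:
  assumes "finite I" "\<And>i. i \<in> I \<Longrightarrow> nonempty_open (U i)" and "\<epsilon> > 0"
  obtains V m where "\<forall>i\<in>I. nonempty_open (V i) \<and> V i \<subseteq> U i" and "m \<ge> M"
    and "\<forall>i\<in>I. \<forall>x\<in>V i. dist ((T ^^ m) x) x < \<epsilon>"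
proof -
  have "\<exists>W k. nonempty_open W \<and> (\<forall>i\<in>I. \<forall>x\<in>W. (T ^^ k i) x \<in> U i)"
    using assms(1,2) by (rule common_source)
  then obtain W k where W: "nonempty_open W" "\<forall>i\<in>I. \<forall>x\<in>W. (T ^^ k i) x \<in> U i"
    by blast
  then obtain x0 where x0: "x0 \<in> W"
    by blast
  define N where "N i = {x \<in> X. dist ((T ^^ k i) x) ((T ^^ k i) x0) < \<epsilon> / 2}" for i
  have N: "openin (top_of_set X) (N i)" for i
    unfolding N_def by (intro open_dist_less continuous_iterate continuous_on_const)
  have "x0 \<in> X"
    using x0 W(1) openin_imp_subset by blast
  have "openin (top_of_set X) (W \<inter> (\<Inter>i\<in>I. X \<inter> N i))"
  proof (cases "I = {}")
    case False
    then show ?thesis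
      using W(1) N \<open>finite I\<close> by (intro openin_Int openin_INT2) auto
  qed (use W(1) in simp)
  moreover have "x0 \<in> W \<inter> (\<Inter>i\<in>I. X \<inter> N i)"
    using x0 \<open>x0 \<in> X\<close> \<open>\<epsilon> > 0\<close> by (simp add: N_def)
  ultimately have "nonempty_open (W \<inter> (\<Inter>i\<in>I. X \<inter> N i))"
    by blast
  then obtain m x where m: "m \<ge> M" "x \<in> W \<inter> (\<Inter>i\<in>I. X \<inter> N i)"
      "(T ^^ m) x \<in> W \<inter> (\<Inter>i\<in>I. X \<inter> N i)"
    by (rule return_time)
  \<comment> \<open>Returning at time \<open>m\<close> is an open condition, and \<open>(T ^^ k i) x\<close> satisfies it.\<close>
  define V where "V i = U i \<inter> {x \<in> X. dist ((T ^^ m) x) x < \<epsilon>}" for i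
  have V: "nonempty_open (V i)" if "i \<in> I" for i
  proof
    show "openin (top_of_set X) (V i)"
      unfolding V_def using assms(2)[OF that]
      by (intro openin_Int open_dist_less continuous_iterate continuous_on_id) auto
    have "x \<in> N i" "(T ^^ m) x \<in> N i"
      using m(2,3) that by blast+
    then have "dist ((T ^^ k i) ((T ^^ m) x)) ((T ^^ k i) x) < \<epsilon>" "(T ^^ k i) x \<in> X"
      using iterate_in by (auto simp: N_def intro: dist_triangle_half_l)
    moreover have "(T ^^ k i) ((T ^^ m) x) = (T ^^ m) ((T ^^ k i) x)"
      by (metis add.commute comp_apply funpow_add)
    moreover have "(T ^^ k i) x \<in> U i"
      using W(2) that m(2) by auto
    ultimately have "(T ^^ k i) x \<in> V i"
      by (simp add: V_def)
    then show "V i \<noteq> {}"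
      by blast
  qed
  show ?thesis
  proof (rule that[of V m])
    show "\<forall>i\<in>I. nonempty_open (V i) \<and> V i \<subseteq> U i"
      using V by (simp add: V_def)
    show "\<forall>i\<in>I. \<forall>x\<in>V i. dist ((T ^^ m) x) x < \<epsilon>"
      by (simp add: V_def)
  qed (rule m(1))
qed

end

locale transitive_product = transitive_system +
  fixes Y :: "'a set"
  assumes Y: "Y \<subseteq> X" "Y \<noteq> {}"
    and product_transitive: "topologically_transitive (X \<times> Y) (map_prod T T)"
begin

lemma map_prod_iterate: "(map_prod T T ^^ n) (x, y) = ((T ^^ n) x, (T ^^ n) y)"
  by (induction n) auto

text \<open>The first factor \<open>X\<close> of the product carries the starting sets and the second factor \<open>Y\<close>
  the target sets: a time \<open>k\<close> leads both from \<open>U\<close> to \<open>U'\<close> and, inside \<open>Y\<close>, from \<open>W\<close> to \<open>W'\<close>.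
  A point going from \<open>U \<inter> T\<^sup>-\<^sup>k U'\<close> to \<open>W \<inter> T\<^sup>-\<^sup>k W'\<close> in time \<open>n\<close> then goes from \<open>U\<close> to \<open>W\<close>, and its
  \<open>k\<close>-th iterate goes from \<open>U'\<close> to \<open>W'\<close>, in that time.\<close>

lemma hitting_time_intersection:
  assumes "nonempty_open U" "nonempty_open U'"
    and "openin (top_of_set X) W" "W \<inter> Y \<noteq> {}" "openin (top_of_set X) W'" "W' \<inter> Y \<noteq> {}"
  obtains A B where "nonempty_open A" "openin (top_of_set X) B" "B \<inter> Y \<noteq> {}"
    "\<forall>n. A \<inter> (T ^^ n) -` B \<noteq> {} \<longrightarrow> U \<inter> (T ^^ n) -` W \<noteq> {} \<and> U' \<inter> (T ^^ n) -` W' \<noteq> {}"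
proof -
  have restrict: "openin (top_of_set Y) (S \<inter> Y)" if "openin (top_of_set X) S" for S
    using that Y(1) by (metis inf.absorb_iff2 inf.commute openin_subtopology_Int subtopology_subtopology)
  have "openin (top_of_set (X \<times> Y)) (U \<times> (W \<inter> Y))" "openin (top_of_set (X \<times> Y)) (U' \<times> (W' \<inter> Y))"
    using assms restrict by (auto intro: openin_Times)
  moreover have "U \<times> (W \<inter> Y) \<noteq> {}" "U' \<times> (W' \<inter> Y) \<noteq> {}"
    using assms by auto
  ultimately obtain k where "U \<times> (W \<inter> Y) \<inter> (map_prod T T ^^ k) -` (U' \<times> (W' \<inter> Y)) \<noteq> {}"
    using product_transitive unfolding topologically_transitive_def by meson
  then have k: "U \<inter> (T ^^ k) -` U' \<noteq> {}" "(W \<inter> (T ^^ k) -` W') \<inter> Y \<noteq> {}"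
    by (auto simp: map_prod_iterate)
  have "U \<inter> (T ^^ n) -` W \<noteq> {} \<and> U' \<inter> (T ^^ n) -` W' \<noteq> {}"
    if hit: "(U \<inter> (T ^^ k) -` U') \<inter> (T ^^ n) -` (W \<inter> (T ^^ k) -` W') \<noteq> {}" for n
  proof -
    obtain x where x: "x \<in> U" "(T ^^ k) x \<in> U'" "(T ^^ n) x \<in> W" "(T ^^ k) ((T ^^ n) x) \<in> W'"
      using hit by auto
    moreover have "(T ^^ k) ((T ^^ n) x) = (T ^^ n) ((T ^^ k) x)"
      by (metis add.commute comp_apply funpow_add)
    ultimately show ?thesis
      by (metis IntI empty_iff vimageI)
  qed
  then show ?thesis
    using k open_visit assms by (intro that[of "U \<inter> (T ^^ k) -` U'" "W \<inter> (T ^^ k) -` W'"]) auto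
qed

text \<open>The result of intersecting finitely many sets of hitting times is again controlled by one pair
  of open sets whose target meets \<open>Y\<close>, so that the previous lemma can be iterated.\<close>

lemma simultaneous_hitting_time:
  assumes "finite I" "\<And>i. i \<in> I \<Longrightarrow> nonempty_open (U i)"
    and W: "openin (top_of_set X) W" "W \<inter> Y \<noteq> {}"
  shows "\<exists>A B. nonempty_open A \<and> openin (top_of_set X) B \<and> B \<inter> Y \<noteq> {} \<and>
    (\<forall>n. A \<inter> (T ^^ n) -` B \<noteq> {} \<longrightarrow> (\<forall>i\<in>I. U i \<inter> (T ^^ n) -` W \<noteq> {}))"
  using assms(1,2)
proof (induction I rule: finite_induct)
  case empty
  have "nonempty_open X"
    using system by (simp add: dynamical_system_def)
  then show ?case
    using W by blast
next
  case (insert j I)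
  have "\<exists>A B. nonempty_open A \<and> openin (top_of_set X) B \<and> B \<inter> Y \<noteq> {} \<and>
    (\<forall>n. A \<inter> (T ^^ n) -` B \<noteq> {} \<longrightarrow> (\<forall>i\<in>I. U i \<inter> (T ^^ n) -` W \<noteq> {}))"
    using insert.prems by (intro insert.IH) blast
  then obtain A B where AB: "nonempty_open A" "openin (top_of_set X) B" "B \<inter> Y \<noteq> {}"
      "\<forall>n. A \<inter> (T ^^ n) -` B \<noteq> {} \<longrightarrow> (\<forall>i\<in>I. U i \<inter> (T ^^ n) -` W \<noteq> {})"
    by blast
  have "nonempty_open (U j)"
    using insert.prems by blast
  then obtain A' B' where AB': "nonempty_open A'" "openin (top_of_set X) B'" "B' \<inter> Y \<noteq> {}"
      "\<forall>n. A' \<inter> (T ^^ n) -` B' \<noteq> {} \<longrightarrow> A \<inter> (T ^^ n) -` B \<noteq> {} \<and> U j \<inter> (T ^^ n) -` W \<noteq> {}"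
    by (rule hitting_time_intersection[OF AB(1) _ AB(2,3) W])
  have "\<forall>n. A' \<inter> (T ^^ n) -` B' \<noteq> {} \<longrightarrow> (\<forall>i\<in>insert j I. U i \<inter> (T ^^ n) -` W \<noteq> {})"
    using AB'(4) AB(4) by (simp only: ball_simps) blast
  then show ?case
    using AB'(1-3) by blast
qed

text \<open>Points that lie at time \<open>n\<close> in a ball of radius \<open>\<epsilon> / 2\<close> around a point of \<open>Y\<close> are then
  \<open>\<epsilon>\<close>-close to each other.\<close>

lemma proximal_refinement:
  assumes "finite I" "\<And>i. i \<in> I \<Longrightarrow> nonempty_open (U i)" and "\<epsilon> > 0"
  obtains V n where "\<forall>i\<in>I. nonempty_open (V i) \<and> V i \<subseteq> U i"
    and "\<forall>i\<in>I. \<forall>j\<in>I. \<forall>x\<in>V i. \<forall>y\<in>V j. dist ((T ^^ n) x) ((T ^^ n) y) < \<epsilon>"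
proof -
  obtain y where y: "y \<in> Y"
    using Y by blast
  define W where "W = X \<inter> ball y (\<epsilon> / 2)"
  have W: "openin (top_of_set X) W" "W \<inter> Y \<noteq> {}"
    using y Y(1) \<open>\<epsilon> > 0\<close> by (auto simp: W_def openin_open_Int)
  obtain A B where AB: "nonempty_open A" "openin (top_of_set X) B" "B \<inter> Y \<noteq> {}"
      "\<forall>n. A \<inter> (T ^^ n) -` B \<noteq> {} \<longrightarrow> (\<forall>i\<in>I. U i \<inter> (T ^^ n) -` W \<noteq> {})"
    using simultaneous_hitting_time[OF assms(1) _ W, of U] assms(2) by metis
  have "nonempty_open B"
    using AB by blast
  then obtain n where n: "nonempty_open (A \<inter> (T ^^ n) -` B)"
    by (rule visit_exists[OF AB(1)])
  show ?thesis
  proof (rule that[of "\<lambda>i. U i \<inter> (T ^^ n) -` W" n]; intro ballI)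
    show "nonempty_open (U i \<inter> (T ^^ n) -` W) \<and> U i \<inter> (T ^^ n) -` W \<subseteq> U i" if "i \<in> I" for i
      using AB(4) n that open_visit[OF _ W(1)] assms(2)[OF that] by blast
    show "dist ((T ^^ n) x) ((T ^^ n) z) < \<epsilon>"
      if "x \<in> U i \<inter> (T ^^ n) -` W" "z \<in> U j \<inter> (T ^^ n) -` W" for i j x z
      using that dist_triangle_half_r[of y _ \<epsilon>] by (auto simp: W_def)
  qed
qed

end

section \<open>Separating finitely many open sets\<close>

lemma distinct_representatives:
  assumes "finite I" "\<And>i. i \<in> I \<Longrightarrow> infinite (U i)"
  shows "\<exists>p. inj_on p I \<and> (\<forall>i\<in>I. p i \<in> U i)"
  using assms
proof (induction I rule: finite_induct)
  case (insert j I)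
  then obtain p where p: "inj_on p I" "\<forall>i\<in>I. p i \<in> U i"
    by auto
  have "infinite (U j - p ` I)"
    using insert.prems insert.hyps(1) by (intro Diff_infinite_finite) auto
  then obtain q where "q \<in> U j - p ` I"
    using infinite_imp_nonempty by (metis ex_in_conv)
  then show ?case
    using p insert.hyps(2) by (intro exI[of _ "p(j := q)"]) (auto simp: inj_on_def)
qed simp

text \<open>In the absence of isolated points every nonempty open set is infinite, so distinct centres
  can be chosen even if the given sets coincide. This is what lets a set split into two.\<close>

lemma disjoint_refinement:
  fixes X :: "'a::metric_space set"
  assumes "closed X" and perfect: "\<forall>x\<in>X. x islimpt X" and "finite I"
    and U: "\<And>i. i \<in> I \<Longrightarrow> openin (top_of_set X) (U i) \<and> U i \<noteq> {}" and "\<epsilon> > 0"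
  obtains V where "\<forall>i\<in>I. openin (top_of_set X) (V i) \<and> V i \<noteq> {} \<and> closure (V i) \<subseteq> U i"
    and "\<forall>i\<in>I. \<forall>x\<in>V i. \<forall>y\<in>V i. dist x y \<le> \<epsilon>"
    and "\<forall>i\<in>I. \<forall>j\<in>I. i \<noteq> j \<longrightarrow> V i \<inter> V j = {}"
proof -
  have "infinite (U i)" if i: "i \<in> I" for i
  proof -
    obtain x where x: "x \<in> U i"
      using conjunct2[OF U[OF i]] by auto
    then have "x \<in> X"
      using openin_imp_subset[OF conjunct1[OF U[OF i]]] by blast
    then show ?thesis
      using infinite_openin[OF conjunct1[OF U[OF i]] x] perfect by simp
  qed
  then have "\<exists>p. inj_on p I \<and> (\<forall>i\<in>I. p i \<in> U i)"
    by (rule distinct_representatives[OF \<open>finite I\<close>])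
  then obtain p where p: "inj_on p I" "\<forall>i\<in>I. p i \<in> U i"
    by blast
  have inside: "\<forall>\<^sub>F r in at_right 0. X \<inter> cball (p i) r \<subseteq> U i" if i: "i \<in> I" for i
  proof -
    obtain e where "e > 0" "ball (p i) e \<inter> X \<subseteq> U i"
      using conjunct1[OF U[OF i]] bspec[OF p(2) i] unfolding openin_contains_ball by auto
    then have "X \<inter> cball (p i) r \<subseteq> U i" if "r < e" for r
      using that by auto
    then show ?thesis
      unfolding eventually_at_right_field using \<open>e > 0\<close> by (intro exI[of _ e]) auto
  qed
  have apart: "\<forall>\<^sub>F r in at_right 0. i \<noteq> j \<longrightarrow> 2 * r < dist (p i) (p j)"
    if "i \<in> I" "j \<in> I" for i j
  proof (cases "i = j")
    case False
    then have "dist (p i) (p j) / 2 > 0"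
      using p(1) that by (auto simp: inj_on_def)
    then show ?thesis
      unfolding eventually_at_right_field by (intro exI[of _ "dist (p i) (p j) / 2"]) auto
  qed simp
  have "\<forall>\<^sub>F r in at_right 0. r > 0 \<and> 2 * r < \<epsilon> \<and> (\<forall>i\<in>I. X \<inter> cball (p i) r \<subseteq> U i) \<and>
      (\<forall>i\<in>I. \<forall>j\<in>I. i \<noteq> j \<longrightarrow> 2 * r < dist (p i) (p j))"
  proof (intro eventually_conj eventually_ball_finite ballI \<open>finite I\<close> inside apart)
    show "\<forall>\<^sub>F r in at_right 0. 2 * r < \<epsilon>"
      unfolding eventually_at_right_field using \<open>\<epsilon> > 0\<close> by (intro exI[of _ "\<epsilon> / 2"]) auto
  qed (simp_all add: eventually_at_right_less)
  from eventually_happens'[OF trivial_limit_at_right_real this]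
  obtain r :: real where r: "r > 0" "2 * r < \<epsilon>" "\<forall>i\<in>I. X \<inter> cball (p i) r \<subseteq> U i"
      "\<forall>i\<in>I. \<forall>j\<in>I. i \<noteq> j \<longrightarrow> 2 * r < dist (p i) (p j)"
    by auto
  show ?thesis
  proof (rule that[of "\<lambda>i. X \<inter> ball (p i) r"]; intro ballI impI)
    fix i assume i: "i \<in> I"
    have "p i \<in> X"
      using bspec[OF p(2) i] openin_imp_subset[OF conjunct1[OF U[OF i]]] by blast
    moreover have "closure (X \<inter> ball (p i) r) \<subseteq> X \<inter> cball (p i) r"
      by (rule closure_minimal) (auto simp: \<open>closed X\<close> closed_Int)
    ultimately show "openin (top_of_set X) (X \<inter> ball (p i) r) \<and> X \<inter> ball (p i) r \<noteq> {} \<and>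
        closure (X \<inter> ball (p i) r) \<subseteq> U i"
      using r(1) bspec[OF r(3) i] by (auto simp: openin_open_Int)
  next
    fix i x y assume "x \<in> X \<inter> ball (p i) r" "y \<in> X \<inter> ball (p i) r"
    then show "dist x y \<le> \<epsilon>"
      using r(2) dist_triangle2[of x y "p i"] by (simp add: dist_commute)
  next
    fix i j assume "i \<in> I" "j \<in> I" "i \<noteq> j"
    show "(X \<inter> ball (p i) r) \<inter> (X \<inter> ball (p j) r) = {}"
    proof (rule ccontr)
      assume "(X \<inter> ball (p i) r) \<inter> (X \<inter> ball (p j) r) \<noteq> {}"
      then obtain z where "dist (p i) z < r" "dist (p j) z < r"
        by auto
      moreover have "2 * r < dist (p i) (p j)"
        using r(4) \<open>i \<in> I\<close> \<open>j \<in> I\<close> \<open>i \<noteq> j\<close> by blast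
      ultimately show False
        using dist_triangle2[of "p i" "p j" z] by linarith
    qed
  qed
qed

section \<open>A forest of Cantor sets\<close>

text \<open>The sets are the nonempty traces on \<open>X\<close> of the balls of radius \<open>1 / (n + 1)\<close> around the points
  of a finite net, for all \<open>n\<close>.\<close>

lemma compact_countable_pi_base:
  fixes X :: "'a::metric_space set"
  assumes "compact X" "X \<noteq> {}"
  obtains G :: "nat \<Rightarrow> 'a set" where "\<forall>j. openin (top_of_set X) (G j) \<and> G j \<noteq> {}"
    and "\<forall>x\<in>X. \<forall>\<epsilon>>0. \<exists>j. G j \<subseteq> ball x \<epsilon>"
proof -
  have "\<exists>K. finite K \<and> X \<subseteq> (\<Union>y\<in>K. ball y (1 / Suc n))" for n
    using assms(1) unfolding compact_eq_totally_bounded by simp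
  then obtain K where K: "\<And>n. finite (K n)" "\<And>n. X \<subseteq> (\<Union>y\<in>K n. ball y (1 / Suc n))"
    by metis
  \<comment> \<open>The centres of the net may lie outside \<open>X\<close>, so empty traces have to be discarded.\<close>
  define \<B> where "\<B> = (\<Union>n. (\<lambda>y. X \<inter> ball y (1 / Suc n)) ` K n) - {{}}"
  have "countable \<B>"
    unfolding \<B>_def using K(1) by (intro countable_Diff countable_UN countable_image) (auto simp: countable_finite)
  have near: "\<exists>B\<in>\<B>. B \<subseteq> ball x \<epsilon>" if "x \<in> X" "\<epsilon> > 0" for x \<epsilon>
  proof -
    obtain n where "1 / Suc n < \<epsilon> / 2"
      using nat_approx_posE[of "\<epsilon> / 2"] \<open>\<epsilon> > 0\<close> by auto
    moreover obtain y where y: "y \<in> K n" "x \<in> ball y (1 / Suc n)"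
      using K(2) \<open>x \<in> X\<close> by blast
    ultimately have "dist x z < \<epsilon>" if "z \<in> ball y (1 / Suc n)" for z
      using that dist_triangle3[of x z y] by simp
    then have "X \<inter> ball y (1 / Suc n) \<subseteq> ball x \<epsilon>"
      by auto
    moreover have "X \<inter> ball y (1 / Suc n) \<in> \<B>"
      using y \<open>x \<in> X\<close> unfolding \<B>_def by blast
    ultimately show ?thesis
      by blast
  qed
  then have "\<B> \<noteq> {}"
    using assms(2) zero_less_one by (metis all_not_in_conv)
  show ?thesis
  proof (rule that[of "from_nat_into \<B>"]; intro allI ballI impI)
    show "openin (top_of_set X) (from_nat_into \<B> j) \<and> from_nat_into \<B> j \<noteq> {}" for j
      using from_nat_into[OF \<open>\<B> \<noteq> {}\<close>, of j] by (auto simp: \<B>_def openin_open_Int)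
    show "\<exists>j. from_nat_into \<B> j \<subseteq> ball x \<epsilon>" if "x \<in> X" "\<epsilon> > 0" for x \<epsilon>
      using near[OF that] from_nat_into_surj[OF \<open>countable \<B>\<close>] by metis
  qed
qed

text \<open>The node \<open>(j, s)\<close> is the node \<open>s\<close> of the \<open>j\<close>-th tree. The \<open>j\<close>-th tree starts with its root at
  stage \<open>j\<close>, so its nodes of depth \<open>n\<close> are present at stage \<open>j + n\<close>.\<close>

definition nodes :: "nat \<Rightarrow> (nat \<times> bool list) set" where
  "nodes k = {(j, s). j + length s = k}"

lemma finite_nodes: "finite (nodes k)"
proof (rule finite_subset)
  show "nodes k \<subseteq> {..k} \<times> {s. set s \<subseteq> UNIV \<and> length s \<le> k}"
    by (auto simp: nodes_def)
  show "finite ({..k} \<times> {s :: bool list. set s \<subseteq> UNIV \<and> length s \<le> k})"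
    by (intro finite_cartesian_product finite_lists_length_le) auto
qed

context transitive_product
begin

text \<open>These are all the requirements on the open sets of stage \<open>k\<close>. Each of them passes to smaller
  nonempty open sets.\<close>

definition tame :: "nat \<Rightarrow> 'i set \<Rightarrow> ('i \<Rightarrow> 'a set) \<Rightarrow> bool" where
  "tame k I V \<longleftrightarrow>
     (\<forall>i\<in>I. nonempty_open (V i)) \<and> (\<forall>i\<in>I. \<forall>x\<in>V i. \<forall>y\<in>V i. dist x y \<le> 1 / Suc k) \<and>
     (\<forall>i\<in>I. \<forall>j\<in>I. i \<noteq> j \<longrightarrow> V i \<inter> V j = {}) \<and>
     (\<exists>m\<ge>k. \<forall>x\<in>\<Union>(V ` I). dist ((T ^^ m) x) x < 1 / Suc k) \<and>
     (\<exists>n. \<forall>x\<in>\<Union>(V ` I). \<forall>y\<in>\<Union>(V ` I). dist ((T ^^ n) x) ((T ^^ n) y) \<le> 1 / Suc k)"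

lemma tame_nonempty_open: "tame k I V \<Longrightarrow> i \<in> I \<Longrightarrow> nonempty_open (V i)"
  by (simp add: tame_def)

lemma tame_small: "tame k I V \<Longrightarrow> i \<in> I \<Longrightarrow> x \<in> V i \<Longrightarrow> y \<in> V i \<Longrightarrow> dist x y \<le> 1 / Suc k"
  by (simp add: tame_def)

lemma tame_disjoint: "tame k I V \<Longrightarrow> i \<in> I \<Longrightarrow> j \<in> I \<Longrightarrow> i \<noteq> j \<Longrightarrow> V i \<inter> V j = {}"
  by (simp add: tame_def)

lemma tame_return:
  "tame k I V \<Longrightarrow> \<exists>m\<ge>k. \<forall>x\<in>\<Union>(V ` I). dist ((T ^^ m) x) x < 1 / Suc k"
  by (simp only: tame_def)

lemma tame_proximal:
  "tame k I V \<Longrightarrow>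
    \<exists>n. \<forall>x\<in>\<Union>(V ` I). \<forall>y\<in>\<Union>(V ` I). dist ((T ^^ n) x) ((T ^^ n) y) \<le> 1 / Suc k"
  by (simp only: tame_def)

text \<open>The refinements for the single requirements can be carried out one after the other, because the
  later ones preserve what the earlier ones have achieved. The separating one comes last since it
  also puts the closures inside the given sets.\<close>

lemma tame_refinement:
  assumes perfect: "\<forall>x\<in>X. x islimpt X"
    and "finite I" and U: "\<And>i. i \<in> I \<Longrightarrow> nonempty_open (U i)"
  shows "\<exists>V. tame k I V \<and> (\<forall>i\<in>I. closure (V i) \<subseteq> U i)"
proof -
  define \<epsilon> where "\<epsilon> = 1 / real (Suc k)"
  then have "\<epsilon> > 0"
    by simp
  obtain V1 n where V1: "\<forall>i\<in>I. nonempty_open (V1 i) \<and> V1 i \<subseteq> U i"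
    "\<forall>i\<in>I. \<forall>j\<in>I. \<forall>x\<in>V1 i. \<forall>y\<in>V1 j. dist ((T ^^ n) x) ((T ^^ n) y) < \<epsilon>"
    using U by (rule proximal_refinement[OF \<open>finite I\<close> _ \<open>\<epsilon> > 0\<close>])
  have "nonempty_open (V1 i)" if "i \<in> I" for i
    using V1(1) that by simp
  then obtain V2 m where V2: "\<forall>i\<in>I. nonempty_open (V2 i) \<and> V2 i \<subseteq> V1 i" "m \<ge> k"
    "\<forall>i\<in>I. \<forall>x\<in>V2 i. dist ((T ^^ m) x) x < \<epsilon>"
    by (rule rigid_refinement[OF \<open>finite I\<close> _ \<open>\<epsilon> > 0\<close>])
  have "closed X"
    using system by (simp add: dynamical_system_def compact_imp_closed)
  have "nonempty_open (V2 i)" if "i \<in> I" for i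
    using V2(1) that by simp
  then obtain V where V: "\<forall>i\<in>I. openin (top_of_set X) (V i) \<and> V i \<noteq> {} \<and> closure (V i) \<subseteq> V2 i"
    "\<forall>i\<in>I. \<forall>x\<in>V i. \<forall>y\<in>V i. dist x y \<le> \<epsilon>"
    "\<forall>i\<in>I. \<forall>j\<in>I. i \<noteq> j \<longrightarrow> V i \<inter> V j = {}"
    by (rule disjoint_refinement[OF \<open>closed X\<close> perfect \<open>finite I\<close> _ \<open>\<epsilon> > 0\<close>])
  have V2_sub: "V i \<subseteq> V2 i" if "i \<in> I" for i
    using V(1) that closure_subset[of "V i"] by auto
  have V1_sub: "V i \<subseteq> V1 i" if "i \<in> I" for i
    using V2(1) V2_sub[OF that] that by auto
  have "\<forall>x\<in>\<Union>(V ` I). dist ((T ^^ m) x) x < \<epsilon>"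
    using V2(3) V2_sub by blast
  moreover have "\<forall>x\<in>\<Union>(V ` I). \<forall>y\<in>\<Union>(V ` I). dist ((T ^^ n) x) ((T ^^ n) y) \<le> \<epsilon>"
  proof (intro ballI)
    fix x y assume "x \<in> \<Union>(V ` I)" "y \<in> \<Union>(V ` I)"
    then obtain i j where "i \<in> I" "x \<in> V1 i" "j \<in> I" "y \<in> V1 j"
      using V1_sub by blast
    then show "dist ((T ^^ n) x) ((T ^^ n) y) \<le> \<epsilon>"
      using V1(2) by (simp add: less_imp_le)
  qed
  moreover have "\<forall>i\<in>I. nonempty_open (V i)"
    using V(1) by simp
  ultimately have "tame k I V"
    unfolding tame_def \<epsilon>_def[symmetric] using V(2,3) V2(2) by (intro conjI) metis+
  moreover have "\<forall>i\<in>I. closure (V i) \<subseteq> U i"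
    using V(1) V2(1) V1(1) by (meson subset_trans)
  ultimately show ?thesis
    by blast
qed

text \<open>At stage \<open>k + 1\<close> both children of a node start from the same set, the one of their parent, and
  the root of the new tree starts from \<open>G (k + 1)\<close>; the disjointness in \<open>tame\<close> separates them.\<close>

lemma tame_forest:
  assumes perfect: "\<forall>x\<in>X. x islimpt X" and G: "\<forall>j. nonempty_open (G j)"
  shows "\<exists>F. \<forall>k. (tame k (nodes k) (F k) \<and> F k (k, []) \<subseteq> G k) \<and>
    (\<forall>j s b. (j, s) \<in> nodes k \<longrightarrow> closure (F (Suc k) (j, b # s)) \<subseteq> F k (j, s))"
proof (rule dependent_nat_choice)
    have "\<exists>V. tame 0 (nodes 0) V \<and> (\<forall>i\<in>nodes 0. closure (V i) \<subseteq> G 0)"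
      by (rule tame_refinement[OF perfect finite_nodes spec[OF G]])
    moreover have "(0, []) \<in> nodes 0"
      by (simp add: nodes_def)
    ultimately show "\<exists>V. tame 0 (nodes 0) V \<and> V (0, []) \<subseteq> G 0"
      using closure_subset by (meson bspec subset_trans)
  next
    fix V k assume V: "tame k (nodes k) V \<and> V (k, []) \<subseteq> G k"
    define U where "U = (\<lambda>(j, s). case s of [] \<Rightarrow> G j | b # s' \<Rightarrow> V (j, s'))"
    have V_open: "nonempty_open (V i)" if "i \<in> nodes k" for i
      using tame_nonempty_open[OF conjunct1[OF V] that] .
    have "nonempty_open (U i)" if i: "i \<in> nodes (Suc k)" for i
    proof -
      obtain j s where js: "i = (j, s)"
        by (cases i)
      show ?thesis
      proof (cases s)
        case Nil
        then show ?thesis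
          using spec[OF G, of j] js by (simp add: U_def)
      next
        case (Cons b s')
        then have "(j, s') \<in> nodes k"
          using i js by (simp add: nodes_def)
        then show ?thesis
          using V_open[of "(j, s')"] js Cons by (simp add: U_def)
      qed
    qed
    then have "\<exists>V'. tame (Suc k) (nodes (Suc k)) V' \<and> (\<forall>i\<in>nodes (Suc k). closure (V' i) \<subseteq> U i)"
      by (rule tame_refinement[OF perfect finite_nodes])
    then obtain V' where V': "tame (Suc k) (nodes (Suc k)) V'"
      "\<forall>i\<in>nodes (Suc k). closure (V' i) \<subseteq> U i"
      by blast
    have "closure (V' (Suc k, [])) \<subseteq> U (Suc k, [])"
      using V'(2) by (simp add: nodes_def)
    then have "V' (Suc k, []) \<subseteq> G (Suc k)"
      using closure_subset[of "V' (Suc k, [])"] by (simp add: U_def)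
    moreover have "\<forall>j s b. (j, s) \<in> nodes k \<longrightarrow> closure (V' (j, b # s)) \<subseteq> V (j, s)"
    proof (intro allI impI)
      fix j s b assume "(j, s) \<in> nodes k"
      then have "(j, b # s) \<in> nodes (Suc k)"
        by (simp add: nodes_def)
      then show "closure (V' (j, b # s)) \<subseteq> V (j, s)"
        using V'(2) by (fastforce simp: U_def)
    qed
    ultimately show "\<exists>V'. (tame (Suc k) (nodes (Suc k)) V' \<and> V' (Suc k, []) \<subseteq> G (Suc k)) \<and>
      (\<forall>j s b. (j, s) \<in> nodes k \<longrightarrow> closure (V' (j, b # s)) \<subseteq> V (j, s))"
      using V'(1) by blast
qed

lemma forest_parametrization:
  assumes F: "\<And>k. tame k (nodes k) (F k)"
    "\<And>k j s b. (j, s) \<in> nodes k \<Longrightarrow> closure (F (Suc k) (j, b # s)) \<subseteq> F k (j, s)"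
  shows "\<exists>f. continuous_on UNIV f \<and> inj f \<and> (\<forall>\<sigma> n. f \<sigma> \<in> F (j + n) (j, branch \<sigma> n))"
proof -
  define A where "A s = F (j + length s) (j, s)" for s
  have node: "(j, s) \<in> nodes (j + length s)" for s
    by (simp add: nodes_def)
  have A_open: "nonempty_open (A s)" for s
    using tame_nonempty_open[OF F(1) node] by (simp add: A_def)
  have "\<exists>f. continuous_on UNIV f \<and> inj f \<and> (\<forall>\<sigma> n. f \<sigma> \<in> A (branch \<sigma> n))"
  proof (rule tree_parametrization[of X A "\<lambda>n. 1 / Suc (j + n)"])
    show "compact X"
      using system by (simp add: dynamical_system_def)
    show "A [] \<subseteq> X" "A s \<noteq> {}" for s
      using A_open[of s] openin_imp_subset[OF conjunct1[OF A_open]] by simp_all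
    show "closure (A (b # s)) \<subseteq> A s" for b s
      using F(2)[OF node] by (simp add: A_def)
    show "dist x y \<le> 1 / Suc (j + length s)" if "x \<in> A s" "y \<in> A s" for x y s
      using tame_small[OF F(1) node] that unfolding A_def .
    show "(\<lambda>n. 1 / real (Suc (j + n))) \<longlonglongrightarrow> 0"
      using LIMSEQ_ignore_initial_segment[OF LIMSEQ_inverse_real_of_nat, of j]
      by (simp add: inverse_eq_divide add.commute)
    show "A s \<inter> A t = {}" if "length s = length t" "s \<noteq> t" for s t
    proof -
      have "(j, t) \<in> nodes (j + length s)" "(j, s) \<noteq> (j, t)"
        using node[of t] that by auto
      then show ?thesis
        using tame_disjoint[OF F(1) node[of s]] that(1) by (simp add: A_def)
    qed
  qed
  then show ?thesis
    by (simp add: A_def)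
qed

text \<open>A tree contributes to \<open>C N\<close> only if its index is at most \<open>N\<close>, that is, if it has been planted
  by stage \<open>N\<close>. Therefore the common times of every stage \<open>k \<ge> N\<close> serve all of \<open>C N\<close>; on the
  union of all the \<open>C N\<close> this leaves pointwise convergence along one sequence of times.\<close>

lemma densely_uniformly_chaotic:
  assumes perfect: "\<forall>x\<in>X. x islimpt X"
  shows "densely_uniformly_chaotic X T"
proof -
  have X: "compact X" "X \<noteq> {}"
    using system by (auto simp: dynamical_system_def)
  obtain G :: "nat \<Rightarrow> 'a set" where G: "\<forall>j. nonempty_open (G j)"
    and base: "\<forall>x\<in>X. \<forall>\<epsilon>>0. \<exists>j. G j \<subseteq> ball x \<epsilon>"
    by (rule compact_countable_pi_base[OF X])
  obtain F where "\<forall>k. (tame k (nodes k) (F k) \<and> F k (k, []) \<subseteq> G k) \<and>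
    (\<forall>j s b. (j, s) \<in> nodes k \<longrightarrow> closure (F (Suc k) (j, b # s)) \<subseteq> F k (j, s))"
    using tame_forest[OF perfect G] by blast
  then have F: "\<And>k. tame k (nodes k) (F k)" "\<And>k. F k (k, []) \<subseteq> G k"
    "\<And>k j s b. (j, s) \<in> nodes k \<Longrightarrow> closure (F (Suc k) (j, b # s)) \<subseteq> F k (j, s)"
    by auto
  have "\<exists>f. continuous_on UNIV f \<and> inj f \<and> (\<forall>\<sigma> n. f \<sigma> \<in> F (j + n) (j, branch \<sigma> n))" for j
    using F(1,3) by (rule forest_parametrization)
  then obtain f where "\<forall>j. continuous_on UNIV (f j) \<and> inj (f j) \<and>
    (\<forall>\<sigma> n. f j \<sigma> \<in> F (j + n) (j, branch \<sigma> n))"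
    by metis
  then have f: "\<And>j. continuous_on UNIV (f j)" "\<And>j. inj (f j)"
    "\<And>j \<sigma> n. f j \<sigma> \<in> F (j + n) (j, branch \<sigma> n)"
    by auto
  have f_node: "\<exists>s. (j, s) \<in> nodes k \<and> f j \<sigma> \<in> F k (j, s)" if "j \<le> k" for j k \<sigma>
    using f(3)[of j \<sigma> "k - j"] that by (intro exI[of _ "branch \<sigma> (k - j)"]) (simp add: nodes_def)
  define C where "C N = (\<Union>j\<le>N. range (f j))" for N
  have C_sub: "C N \<subseteq> \<Union>(F k ` nodes k)" if "N \<le> k" for N k
  proof
    fix x assume "x \<in> C N"
    then obtain j \<sigma> where "j \<le> N" "x = f j \<sigma>"
      unfolding C_def by auto
    then have "j \<le> k"
      using that by simp
    then show "x \<in> \<Union>(F k ` nodes k)"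
      using f_node[of j k \<sigma>] \<open>x = f j \<sigma>\<close> by blast
  qed
  have C_X: "C N \<subseteq> X" for N
  proof -
    have "F N i \<subseteq> X" if "i \<in> nodes N" for i
      using openin_imp_subset[OF conjunct1[OF tame_nonempty_open[OF F(1) that]]] .
    then show ?thesis
      using C_sub[of N N] by blast
  qed
  have C_Suc: "C N \<subseteq> C (Suc N)" for N
    unfolding C_def by (intro UN_mono) auto
  \<comment> \<open>Different trees are disjoint, as they sit in different nodes at a common stage.\<close>
  have cantor: "cantor_set (C N)" for N
  proof (induction N)
    case 0
    then show ?case
      using cantor_set_range[OF f(1,2)] by (simp add: C_def)
  next
    case (Suc N)
    have distinct: "f j \<sigma> \<noteq> f (Suc N) \<tau>" if "j \<le> N" for j \<sigma> \<tau>
    proof -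
      obtain s t where s: "(j, s) \<in> nodes (Suc N)" "f j \<sigma> \<in> F (Suc N) (j, s)"
        and t: "(Suc N, t) \<in> nodes (Suc N)" "f (Suc N) \<tau> \<in> F (Suc N) (Suc N, t)"
        using f_node[OF le_SucI[OF \<open>j \<le> N\<close>], of \<sigma>] f_node[OF order_refl, of "Suc N" \<tau>] by blast
      have "(j, s) \<noteq> (Suc N, t)"
        using that by simp
      then have "F (Suc N) (j, s) \<inter> F (Suc N) (Suc N, t) = {}"
        by (rule tame_disjoint[OF F(1) s(1) t(1)])
      then show ?thesis
        using s(2) t(2) by auto
    qed
    have "C N \<inter> range (f (Suc N)) = {}"
    proof (rule ccontr)
      assume "C N \<inter> range (f (Suc N)) \<noteq> {}"
      then obtain x where "x \<in> C N" "x \<in> range (f (Suc N))"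
        by blast
      then obtain j \<sigma> \<tau> where "j \<le> N" "x = f j \<sigma>" "x = f (Suc N) \<tau>"
        unfolding C_def by blast
      then show False
        using distinct[of j \<sigma> \<tau>] by simp
    qed
    moreover have "C (Suc N) = C N \<union> range (f (Suc N))"
      unfolding C_def by (auto simp: atMost_Suc)
    ultimately show ?case
      using cantor_set_Un[OF Suc cantor_set_range[OF f(1,2)]] by simp
  qed
  have small: "\<exists>k\<ge>M. 1 / real (Suc k) < \<epsilon>" if "\<epsilon> > 0" for M \<epsilon>
  proof -
    obtain n where "1 / real (Suc n) < \<epsilon>"
      using nat_approx_posE[OF \<open>\<epsilon> > 0\<close>] by metis
    moreover have "1 / real (Suc (max M n)) \<le> 1 / real (Suc n)"
      by (intro divide_left_mono) auto
    ultimately show ?thesis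
      by (intro exI[of _ "max M n"]) auto
  qed
  have returns: "\<exists>m\<ge>M. \<forall>x\<in>C N. dist ((T ^^ m) x) x < \<epsilon>" if "\<epsilon> > 0" for N M \<epsilon>
  proof -
    obtain k where k: "max M N \<le> k" "1 / real (Suc k) < \<epsilon>"
      using small[OF \<open>\<epsilon> > 0\<close>] by blast
    obtain m where m: "m \<ge> k" "\<forall>x\<in>\<Union>(F k ` nodes k). dist ((T ^^ m) x) x < 1 / Suc k"
      using tame_return[OF F(1)] by blast
    have "dist ((T ^^ m) x) x < \<epsilon>" if "x \<in> C N" for x
    proof -
      have "x \<in> \<Union>(F k ` nodes k)"
        using C_sub[of N k] k(1) that by auto
      then show ?thesis
        using m(2) k(2) less_trans by blast
    qed
    then show ?thesis
      using m(1) k(1) by (intro exI[of _ m]) auto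
  qed
  have uniformly_proximal: "uniformly_proximal T (C N)" for N
  proof (rule uniformly_proximal_of_dist_le)
    fix \<epsilon> :: real assume "\<epsilon> > 0"
    obtain k where k: "N \<le> k" "1 / real (Suc k) < \<epsilon>"
      using small[OF \<open>\<epsilon> > 0\<close>] by blast
    obtain n where n: "\<forall>x\<in>\<Union>(F k ` nodes k). \<forall>y\<in>\<Union>(F k ` nodes k). dist ((T ^^ n) x) ((T ^^ n) y) \<le> 1 / Suc k"
      using tame_proximal[OF F(1)] by blast
    have "dist ((T ^^ n) x) ((T ^^ n) y) \<le> \<epsilon>" if "x \<in> C N" "y \<in> C N" for x y
    proof -
      have "dist ((T ^^ n) x) ((T ^^ n) y) \<le> 1 / Suc k"
        using bspec[OF bspec[OF n subsetD[OF C_sub[OF k(1)] that(1)]] subsetD[OF C_sub[OF k(1)] that(2)]] .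
      then show ?thesis
        using k(2) by linarith
    qed
    then show "\<exists>n. \<forall>x\<in>C N. \<forall>y\<in>C N. dist ((T ^^ n) x) ((T ^^ n) y) \<le> \<epsilon>"
      by blast
  qed
  have "bounded ((T ^^ n) ` C N)" for n N
    by (rule bounded_subset[OF compact_imp_bounded[OF X(1)]]) (use C_X iterate_in in blast)
  then have "proximal T (\<Union>N. C N)"
    by (intro proximal_increasing_Union C_Suc uniformly_proximal)
  moreover have "rigid T (\<Union>N. C N)"
    by (intro rigid_increasing_Union C_Suc returns)
  moreover have "uniformly_rigid T (C N)" for N
    unfolding uniformly_rigid_def by (intro allI impI returns)
  ultimately have "uniformly_chaotic_set X T (\<Union>N. C N)"
    unfolding uniformly_chaotic_set_def using C_X cantor C_Suc uniformly_proximal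
    by (intro conjI exI[of _ C] UN_least allI) auto
  moreover have "x \<in> closure (\<Union>N. C N)" if "x \<in> X" for x
    unfolding closure_approachable
  proof (intro allI impI)
    fix \<epsilon> :: real assume "\<epsilon> > 0"
    then obtain j where "G j \<subseteq> ball x \<epsilon>"
      using base \<open>x \<in> X\<close> by blast
    moreover have "f j \<sigma> \<in> G j" for \<sigma>
      using f(3)[of j \<sigma> 0] F(2)[of j] by auto
    ultimately have "dist (f j \<sigma>) x < \<epsilon>" for \<sigma>
      by (metis dist_commute mem_ball subsetD)
    moreover have "f j \<sigma> \<in> (\<Union>N. C N)" for \<sigma>
      unfolding C_def by blast
    ultimately show "\<exists>y\<in>\<Union>N. C N. dist y x < \<epsilon>"
      by blast
  qed
  ultimately show ?thesis
    unfolding densely_uniformly_chaotic_def by blast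
qed

end

theorem theorem3p1:
  fixes X :: "'a::metric_space set" and T :: "'a \<Rightarrow> 'a"
  assumes "dynamical_system X T"
    and "topologically_transitive X T"
    and "\<forall>x\<in>X. x islimpt X"
    and "\<exists>Y. subsystem X T Y \<and> topologically_transitive (X \<times> Y) (map_prod T T)"
  shows "densely_uniformly_chaotic X T"
proof -
  obtain Y where Y: "subsystem X T Y" "topologically_transitive (X \<times> Y) (map_prod T T)"
    using assms(4) by blast
  interpret transitive_product X T Y
    using assms(1,2) Y closedin_imp_subset by unfold_locales (auto simp: subsystem_def)
  show ?thesis
    using assms(3) by (rule densely_uniformly_chaotic)
qed

end
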